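(* Let $k\ge 3$ be an integer, $\lambda_{\max}=1+\frac{2\sqrt{k-1}}{k}$, $\lambda_{\min}=1-\frac{2\sqrt{k-1}}{k}$, and consider the Polyak Momentum (Heavy Ball) method applied to $\min_x f(x)=\frac12x^\top\mathbf{L}x$, where $L$ is the gossip matrix of random $k$-regular graphs: $x_1=x_0-\frac{2}{\lambda_{\max}+\lambda_{\min}}\nabla f(x_0)$ and, for $t=1,2,\dots$, $$x_{t+1}=x_t+\left(\frac{\sqrt{\lambda_{\max}}-\sqrt{\lambda_{\min}}}{\sqrt{\lambda_{\max}}+\sqrt{\lambda_{\min}}}\right)^2(x_t-x_{t-1})-\left(\frac{2}{\sqrt{\lambda_{\max}}+\sqrt{\lambda_{\min}}}\right)^2\nabla f(x_t).$$ Then its expected error in the average-case framework (see context) satisfies, as $t\to\infty$, $$\mathbb{E}\|x_t-x_*\|^2=\Theta\left(\left(\frac{1}{k-1}\right)^t\right).$$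
   Context: Setting. For a $k$-regular graph $G$ on $n$ vertices with adjacency matrix $A(G)$, the gossip matrix is $L=I_n-\frac1k A(G)$; $\mathbf{L}=L\otimes I_d$; the objective is $f(x)=\frac12x^\top\mathbf{L}x$ on $\mathbb{R}^{nd}$, so $\nabla f(x)=\mathbf{L}x$; $x_*$ is the consensus vector, each of whose $n$ blocks in $\mathbb{R}^d$ equals the average of the blocks of $x_0$. Residual polynomial. The Polyak Momentum (Heavy Ball) method $x_1=x_0-\frac{2}{\lambda_{\max}+\lambda_{\min}}\mathbf{L}x_0$, $x_{t+1}=x_t+\left(\frac{\sqrt{\lambda_{\max}}-\sqrt{\lambda_{\min}}}{\sqrt{\lambda_{\max}}+\sqrt{\lambda_{\min}}}\right)^2(x_t-x_{t-1})-\left(\frac{2}{\sqrt{\lambda_{\max}}+\sqrt{\lambda_{\min}}}\right)^2\mathbf{L}x_t$ for $t\ge1$, with predetermined coefficients given by $\lambda_{\max}=1+\frac{2\sqrt{k-1}}{k}$ and $\lambda_{\min}=1-\frac{2\sqrt{k-1}}{k}$, determines real polynomials $P_t$ of degree $t$ with $P_t(0)=1$ such that $x_t-x_*=P_t(\mathbf{L})(x_0-x_* )$; here $P_t$ is obtained by replacing $\mathbf{L}$ by the scalar variable $\lambda$ and the iterates $x_t$ by $P_t(\lambda)$, starting with $P_0=1$ (using $\mathbf{L}x_*=0$). Average-case framework. It is assumed that $x_0-x_*$ is independent of the random matrix $L$ and $\mathbb{E}(x_0-x_* )(x_0-x_* )^\top=R^2I$ with $R>0$. The expected spectral distribution of the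 gossip matrix of random $k$-regular graphs is taken to be its large-$n$ limit, the measure $$d\mu(\lambda)=\frac{k}{2\pi}\,\frac{\sqrt{\frac{4(k-1)}{k^2}-(1-\lambda)^2}}{1-(1-\lambda)^2}\,d\lambda\quad\text{on}\quad[\lambda_{\min},\lambda_{\max}],$$ and the expected error at iteration $t$ is given by $\mathbb{E}\|x_t-x_*\|^2=R^2\int P_t(\lambda)^2\,d\mu(\lambda)$; this integral is the quantity estimated in the claim. $\Theta$ is with respect to $t\to\infty$ with $k$ and $R$ fixed: $a_t=\Theta(b_t)$ means there are constants $c,C>0$ (not depending on $t$) with $c\,b_t\le a_t\le C\,b_t$ for all sufficiently large $t$. *)

theory Defs
  imports
    "HOL-Analysis.Analysis"
    "HOL-Computational_Algebra.Polynomial"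
    "HOL-Library.Landau_Symbols"
begin

definition lambda_max :: "nat \<Rightarrow> real" where
  "lambda_max k = 1 + 2 * sqrt (real k - 1) / real k"

definition lambda_min :: "nat \<Rightarrow> real" where
  "lambda_min k = 1 - 2 * sqrt (real k - 1) / real k"

text \<open>
  Polyak momentum with predetermined coefficients, for gradient map \<open>g\<close> and starting point \<open>x0\<close>.
  The scalar multiplication \<open>s\<close> is a parameter so that the same method can be run both on
  vectors (\<open>s\<close> is \<open>(*\<^sub>R)\<close>) and on polynomials (\<open>s\<close> is \<open>smult\<close>).
\<close>
fun heavy_ball ::
  "(real \<Rightarrow> 'v \<Rightarrow> 'v::ab_group_add) \<Rightarrow> nat \<Rightarrow> ('v \<Rightarrow> 'v) \<Rightarrow> 'v \<Rightarrow> nat \<Rightarrow> 'v" where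
  "heavy_ball s k g x0 0 = x0"
| "heavy_ball s k g x0 (Suc 0) = x0 - s (2 / (lambda_max k + lambda_min k)) (g x0)"
| "heavy_ball s k g x0 (Suc (Suc t)) =
     heavy_ball s k g x0 (Suc t)
     + s (((sqrt (lambda_max k) - sqrt (lambda_min k)) /
           (sqrt (lambda_max k) + sqrt (lambda_min k)))\<^sup>2)
         (heavy_ball s k g x0 (Suc t) - heavy_ball s k g x0 t)
     - s ((2 / (sqrt (lambda_max k) + sqrt (lambda_min k)))\<^sup>2)
         (g (heavy_ball s k g x0 (Suc t)))"

text \<open>
  The gradient of the quadratic objective is multiplication by the matrix; replacing the matrix
  by the polynomial variable \<open>[:0, 1:]\<close> and starting from \<open>1\<close> gives the residual polynomials.
  Lemma \<open>heavy_ball_residual\<close> below relates them to the vector iterates.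
\<close>
definition residual_poly :: "nat \<Rightarrow> nat \<Rightarrow> real poly" where
  "residual_poly k t = heavy_ball smult k (\<lambda>p. [:0, 1:] * p) 1 t"

text \<open>
  Limiting expected spectral distribution of the gossip matrix of random \<open>k\<close>-regular graphs
  (the Kesten--McKay law transported by \<open>a \<mapsto> 1 - a / k\<close>).
\<close>
definition spectral_measure :: "nat \<Rightarrow> real measure" where
  "spectral_measure k = density lborel (\<lambda>x. ennreal
     (indicator {lambda_min k..lambda_max k} x *
      (real k / (2 * pi) *
       (sqrt (4 * (real k - 1) / (real k)\<^sup>2 - (1 - x)\<^sup>2) / (1 - (1 - x)\<^sup>2)))))"

text \<open>
  The quantity \<open>E \<parallel>x\<^sub>t - x\<^sub>*\<parallel>\<^sup>2\<close> of the average-case framework, in which \<open>x\<^sub>0 - x\<^sub>*\<close> is independent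
  of the gossip matrix with second moment \<open>R\<^sup>2 I\<close> and the expected spectral distribution is taken
  to be the limit law.
\<close>
definition expected_error :: "nat \<Rightarrow> real \<Rightarrow> nat \<Rightarrow> real" where
  "expected_error k R t =
     R\<^sup>2 * (\<integral>x. (poly (residual_poly k t) x)\<^sup>2 \<partial>spectral_measure k)"


subsection \<open>Relation to the iterates on a regular graph\<close>

text \<open>Vectors in \<open>\<real>\<^sup>n\<^sup>d\<close> are represented by their \<open>n\<close> blocks in \<open>\<real>\<^sup>d\<close>.\<close>

definition regular_graph :: "nat \<Rightarrow> ('n::finite \<Rightarrow> 'n \<Rightarrow> bool) \<Rightarrow> bool" where
  "regular_graph k E \<longleftrightarrow>
     (\<forall>i j. E i j \<longrightarrow> E j i) \<and> (\<forall>i. \<not> E i i) \<and> (\<forall>i. card {j. E i j} = k)"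

definition adjacency_matrix :: "('n::finite \<Rightarrow> 'n \<Rightarrow> bool) \<Rightarrow> real^'n^'n" where
  "adjacency_matrix E = (\<chi> i j. if E i j then 1 else 0)"

definition gossip_matrix :: "nat \<Rightarrow> ('n::finite \<Rightarrow> 'n \<Rightarrow> bool) \<Rightarrow> real^'n^'n" where
  "gossip_matrix k E = mat 1 - (1 / real k) *\<^sub>R adjacency_matrix E"

text \<open>The action of \<open>L \<otimes> I\<^sub>d\<close>.\<close>
definition block_apply :: "real^'n^'n \<Rightarrow> (real^'d)^'n \<Rightarrow> (real^'d)^'n" where
  "block_apply L x = (\<chi> i. \<Sum>j\<in>UNIV. L $ i $ j *\<^sub>R x $ j)"

definition objective :: "real^'n^'n \<Rightarrow> (real^'d)^'n \<Rightarrow> real" where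
  "objective L x = 1 / 2 * (x \<bullet> block_apply L x)"

definition consensus :: "(real^'d)^'n \<Rightarrow> (real^'d)^'n" where
  "consensus x = (\<chi> i. (1 / real CARD('n)) *\<^sub>R (\<Sum>j\<in>UNIV. x $ j))"

definition poly_op :: "real poly \<Rightarrow> ('v::real_vector \<Rightarrow> 'v) \<Rightarrow> 'v \<Rightarrow> 'v" where
  "poly_op p A v = (\<Sum>i\<le>degree p. coeff p i *\<^sub>R (A ^^ i) v)"

lemma lambda_min_pos:
  assumes "k \<ge> 3"
  shows "lambda_min k > 0"
proof -
  have "(2 * sqrt (real k - 1))\<^sup>2 < (real k)\<^sup>2"
  proof -
    have "0 < (real k - 2)\<^sup>2" using assms by simp
    then show ?thesis using assms by (simp add: power_mult_distrib power2_eq_square algebra_simps)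
  qed
  then have "2 * sqrt (real k - 1) < real k"
    by (rule power2_less_imp_less) simp
  then show ?thesis using assms by (simp add: lambda_min_def)
qed

lemma residual_poly_0: "poly (residual_poly k t) 0 = 1"
  by (induction t rule: induct_nat_012) (simp_all add: residual_poly_def)

lemma degree_residual_poly:
  assumes "k \<ge> 3"
  shows "degree (residual_poly k t) = t"
proof -
  let ?c = "(2 / (sqrt (lambda_max k) + sqrt (lambda_min k)))\<^sup>2"
  have M: "lambda_max k > 0"
    using assms by (auto simp: lambda_max_def intro!: add_pos_nonneg)
  then have c: "?c \<noteq> 0"
    using lambda_min_pos[OF assms] by (simp add: add_pos_pos less_imp_neq[symmetric])
  show ?thesis
  proof (induction t rule: induct_nat_012)
    case 0
    show ?case by (simp add: residual_poly_def)
  next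
    case 1
    have "lambda_max k + lambda_min k = 2" by (simp add: lambda_max_def lambda_min_def)
    then have "residual_poly k (Suc 0) = [:1, -1:]"
      by (simp add: residual_poly_def one_pCons)
    then show ?case by simp
  next
    case (ge2 t)
    let ?P = "residual_poly k"
    let ?q = "?P (Suc t) + smult (((sqrt (lambda_max k) - sqrt (lambda_min k)) /
           (sqrt (lambda_max k) + sqrt (lambda_min k)))\<^sup>2) (?P (Suc t) - ?P t)"
    let ?r = "smult ?c ([:0, 1:] * ?P (Suc t))"
    have P: "?P (Suc (Suc t)) = - ?r + ?q"
      unfolding residual_poly_def heavy_ball.simps by (simp only: algebra_simps)
    have "?P (Suc t) \<noteq> 0" using ge2.IH(2) by auto
    then have r: "degree (- ?r) = Suc (Suc t)"
      using c ge2.IH(2) by (simp only: degree_minus degree_smult_eq degree_mult_eq) simp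
    have "degree ?q \<le> Suc t"
      by (intro degree_add_le order.trans[OF degree_smult_le] degree_diff_le)
        (use ge2.IH in auto)
    then have "degree ?q < degree (- ?r)" using r by linarith
    then show ?case unfolding P using r by (simp only: degree_add_eq_left)
  qed
qed

lemma linear_block_apply: "linear (block_apply L)"
  by (rule linearI)
    (auto simp: block_apply_def vec_eq_iff sum.distrib sum_distrib_left algebra_simps)

lemma gossip_sym:
  assumes "regular_graph k E"
  shows "gossip_matrix k E $ i $ j = gossip_matrix k E $ j $ i"
  using assms by (auto simp: gossip_matrix_def adjacency_matrix_def mat_def regular_graph_def)

lemma objective_has_gradient:
  fixes x :: "(real^'d)^'n"
  assumes "\<And>i j. L $ i $ j = L $ j $ i"
  shows "(objective L has_derivative (\<lambda>h. block_apply L x \<bullet> h)) (at x)"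
proof -
  have bl: "bounded_linear (block_apply L :: (real^'d)^'n \<Rightarrow> _)"
    by (simp add: linear_block_apply linear_conv_bounded_linear[symmetric])
  have sa: "u \<bullet> block_apply L v = block_apply L u \<bullet> v" for u v :: "(real^'d)^'n"
  proof -
    have "u \<bullet> block_apply L v = (\<Sum>i\<in>UNIV. \<Sum>j\<in>UNIV. L $ i $ j * (u $ i \<bullet> v $ j))"
      by (simp add: inner_vec_def[of u] block_apply_def inner_sum_right)
    also have "\<dots> = (\<Sum>j\<in>UNIV. \<Sum>i\<in>UNIV. L $ j $ i * (u $ i \<bullet> v $ j))"
      by (subst sum.swap) (intro sum.cong refl, simp only: assms)
    also have "\<dots> = block_apply L u \<bullet> v"
      by (simp add: inner_vec_def[of _ v] block_apply_def inner_sum_left)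
    finally show ?thesis .
  qed
  have "(objective L has_derivative
      (\<lambda>h. 1 / 2 * (x \<bullet> block_apply L h + h \<bullet> block_apply L x))) (at x)"
    unfolding objective_def
    by (intro derivative_intros bounded_linear.has_derivative[OF bl]) 
  moreover have "1 / 2 * (x \<bullet> block_apply L h + h \<bullet> block_apply L x) = block_apply L x \<bullet> h" for h
    using sa[of x h] by (simp add: inner_commute[of h])
  ultimately show ?thesis by simp
qed

lemma block_apply_consensus:
  assumes "regular_graph k E" "k > 0"
  shows "block_apply (gossip_matrix k E) (consensus x) = 0"
proof -
  have row: "(\<Sum>j\<in>UNIV. gossip_matrix k E $ i $ j) = 0" for i
  proof -
    have "(\<Sum>j\<in>UNIV. (if E i j then 1 else 0::real)) = real k"
      using assms by (simp add: sum.If_cases regular_graph_def)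
    then show ?thesis
      using assms(2)
      by (simp add: gossip_matrix_def adjacency_matrix_def mat_def sum_subtractf
          flip: sum_distrib_left sum_divide_distrib)
  qed
  show ?thesis
    by (simp add: block_apply_def consensus_def scaleR_sum_left[symmetric] row zero_vec_def
        del: scaleR_scaleR sum_component)
qed

lemma poly_op_bound:
  assumes "degree p \<le> n"
  shows "poly_op p A v = (\<Sum>i\<le>n. coeff p i *\<^sub>R (A ^^ i) v)"
  unfolding poly_op_def
  by (rule sum.mono_neutral_left) (use assms in \<open>auto simp: coeff_eq_0\<close>)

lemma poly_op_add: "poly_op (p + q) A v = poly_op p A v + poly_op q A v"
  by (simp add: poly_op_bound[of _ "max (degree p) (degree q)"] degree_add_le
      scaleR_add_left sum.distrib)

lemma poly_op_smult: "poly_op (smult c p) A v = c *\<^sub>R poly_op p A v"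
  by (simp add: poly_op_bound[of _ "degree p"] degree_smult_le scaleR_sum_right)

lemma poly_op_diff: "poly_op (p - q) A v = poly_op p A v - poly_op q A v"
  using poly_op_add[of "p - q" q A v] by (simp add: algebra_simps)

lemma poly_op_var:
  assumes "linear A"
  shows "poly_op ([:0, 1:] * p) A v = A (poly_op p A v)"
proof -
  have "poly_op ([:0, 1:] * p) A v = (\<Sum>i\<le>Suc (degree p). coeff (pCons 0 p) i *\<^sub>R (A ^^ i) v)"
    by (simp add: poly_op_bound[of _ "Suc (degree p)"] degree_pCons_le)
  also have "\<dots> = A (poly_op p A v)"
    by (simp add: sum.atMost_Suc_shift poly_op_def linear_sum[OF assms] linear_cmul[OF assms]
        del: sum.atMost_Suc)
  finally show ?thesis .
qed

lemma heavy_ball_residual: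
  assumes "linear A" "A xs = 0"
  shows "heavy_ball (*\<^sub>R) k A x0 t - xs = poly_op (residual_poly k t) A (x0 - xs)"
proof -
  have A: "A (heavy_ball (*\<^sub>R) k A x0 t) = A (heavy_ball (*\<^sub>R) k A x0 t - xs)" for t
    by (simp add: linear_diff[OF assms(1)] assms(2))
  show ?thesis
  proof (induction t rule: induct_nat_012)
    case 0
    show ?case by (simp add: residual_poly_def poly_op_def)
  next
    case 1
    have "poly_op 1 A v = v" for v by (simp add: poly_op_def)
    then show ?case
      by (simp add: residual_poly_def poly_op_diff poly_op_smult poly_op_var[OF assms(1)]
          linear_diff[OF assms(1)] assms(2) del: mult_pCons_left mult_1_right)
  next
    case (ge2 t)
    let ?P = "\<lambda>t. poly_op (residual_poly k t) A (x0 - xs)"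
    have "poly_op (residual_poly k (Suc (Suc t))) A (x0 - xs) = ?P (Suc t)
     + (((sqrt (lambda_max k) - sqrt (lambda_min k)) /
           (sqrt (lambda_max k) + sqrt (lambda_min k)))\<^sup>2) *\<^sub>R (?P (Suc t) - ?P t)
     - ((2 / (sqrt (lambda_max k) + sqrt (lambda_min k)))\<^sup>2) *\<^sub>R A (?P (Suc t))"
      by (simp add: residual_poly_def poly_op_diff poly_op_add poly_op_smult
          poly_op_var[OF assms(1)] del: mult_pCons_left)
    then show ?case
      by (simp add: A[of "Suc t"] flip: ge2.IH)
  qed
qed

corollary heavy_ball_gossip_residual:
  assumes "regular_graph k E" "k > 0"
  shows "heavy_ball (*\<^sub>R) k (block_apply (gossip_matrix k E)) x0 t - consensus x0 =
    poly_op (residual_poly k t) (block_apply (gossip_matrix k E)) (x0 - consensus x0)"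
  by (rule heavy_ball_residual[OF linear_block_apply block_apply_consensus[OF assms]])

end

theory Submission
  imports Defs
begin

text \<open>
  Write \<open>q = k - 1\<close>. With the prescribed coefficients the heavy ball recurrence becomes
  \<open>P\<^sub>t\<^sub>+\<^sub>2 = (k (1 - \<lambda>) P\<^sub>t\<^sub>+\<^sub>1 - P\<^sub>t) / q\<close>, the recurrence that governs non-backtracking walks on the
  \<open>k\<close>-regular tree. Put \<open>\<lambda> = 1 - (2 \<surd>q / k) cos \<theta>\<close>, which maps \<open>[0, \<pi>]\<close> increasingly onto the
  support of the spectral measure. Then \<open>(\<surd>q)\<^sup>t k sin \<theta> P\<^sub>t\<close> satisfies the recurrence of
  \<open>sin (m \<theta>)\<close>, hence equals \<open>S\<^sub>t = q sin ((t + 1) \<theta>) - sin ((t - 1) \<theta>)\<close>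
  (lemma \<open>residual_poly_trig\<close>). The factor \<open>q\<^sup>-\<^sup>t\<close> of the claim is already visible here: the error is
  \<open>q\<^sup>-\<^sup>t\<close> times a constant times \<open>\<integral> S\<^sub>t\<^sup>2 / D\<close> over \<open>[0, \<pi>]\<close>, where
  \<open>D = q\<^sup>2 + 1 - 2 q cos (2 \<theta>)\<close> comes from the density (lemma \<open>integral_spectral_measure\<close>).

  That last integral does not depend on \<open>t \<ge> 1\<close>. With \<open>z = exp (2 i \<theta>)\<close> one has \<open>D = \<bar>q z - 1\<bar>\<^sup>2\<close>
  and \<open>S\<^sub>t = Im (exp (i (t - 1) \<theta>) (q z - 1))\<close>, so \<open>2 S\<^sub>t\<^sup>2 = D - N\<^sub>t\<close> where
  \<open>N\<^sub>t = Re (z\<^sup>t\<^sup>-\<^sup>1 (q z - 1)\<^sup>2)\<close> satisfies \<open>\<bar>N\<^sub>t\<bar> \<le> D\<close>. The integrals \<open>I\<^sub>t\<close> of \<open>N\<^sub>t / D\<close> satisfy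
  \<open>I\<^sub>t\<^sub>+\<^sub>1 = q I\<^sub>t\<close> and are bounded by \<open>\<pi>\<close>; as \<open>q > 1\<close>, they vanish
  (lemma \<open>integral_oscillation_eq_0\<close>). This leaves \<open>\<integral> S\<^sub>t\<^sup>2 / D = \<pi> / 2\<close> and gives the exact error
  \<open>R\<^sup>2 (q / k) q\<^sup>-\<^sup>t\<close> for every \<open>t \<ge> 1\<close> (theorem \<open>expected_error_eq\<close>).
\<close>

section \<open>The recurrence in the angular variable\<close>

lemma sqrt_lambda_max:
  assumes "k \<ge> 3"
  shows "sqrt (lambda_max k) = (sqrt (real k - 1) + 1) / sqrt (real k)"
proof -
  have "lambda_max k = (sqrt (real k - 1) + 1)\<^sup>2 / real k"
    using assms by (simp add: lambda_max_def power2_sum field_simps)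
  then show ?thesis using assms by (simp add: real_sqrt_divide)
qed

lemma sqrt_lambda_min:
  assumes "k \<ge> 3"
  shows "sqrt (lambda_min k) = (sqrt (real k - 1) - 1) / sqrt (real k)"
proof -
  have "lambda_min k = (sqrt (real k - 1) - 1)\<^sup>2 / real k"
    using assms by (simp add: lambda_min_def power2_diff field_simps)
  then show ?thesis using assms by (simp add: real_sqrt_divide)
qed

text \<open>
  The two square roots are \<open>(\<surd>q \<plusminus> 1) / \<surd>k\<close> for \<open>q = k - 1\<close>, so the momentum coefficient is \<open>1 / q\<close> and
  the step size \<open>k / q\<close>. As \<open>1 + 1 / q = k / q\<close> too, the middle term is \<open>(k / q) (1 - x) P\<^sub>t\<^sub>+\<^sub>1\<close>.
\<close>

lemma residual_poly_rec:
  assumes "k \<ge> 3"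
  shows "poly (residual_poly k (Suc (Suc t))) x =
    (real k * (1 - x) * poly (residual_poly k (Suc t)) x - poly (residual_poly k t) x) / (real k - 1)"
proof -
  let ?a = "sqrt (lambda_max k)" and ?b = "sqrt (lambda_min k)"
  have q: "real k - 1 > 0" and k: "real k > 0" using assms by auto
  have sum: "?a + ?b = 2 * sqrt (real k - 1) / sqrt (real k)"
    and diff: "?a - ?b = 2 / sqrt (real k)"
    by (simp_all add: sqrt_lambda_max[OF assms] sqrt_lambda_min[OF assms]
        flip: add_divide_distrib diff_divide_distrib)
  have A: "((?a - ?b) / (?a + ?b))\<^sup>2 = 1 / (real k - 1)"
    unfolding sum diff using q k by (simp add: power_divide power_mult_distrib)
  have B: "(2 / (?a + ?b))\<^sup>2 = real k / (real k - 1)"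
    unfolding sum using q k by (simp add: power_divide power_mult_distrib)
  have "poly (residual_poly k (Suc (Suc t))) x = poly (residual_poly k (Suc t)) x
      + ((?a - ?b) / (?a + ?b))\<^sup>2 * (poly (residual_poly k (Suc t)) x - poly (residual_poly k t) x)
      - (2 / (?a + ?b))\<^sup>2 * (x * poly (residual_poly k (Suc t)) x)"
    by (simp add: residual_poly_def)
  moreover have "p + 1 / q * (p - p') - (q + 1) / q * (x * p) = ((q + 1) * (1 - x) * p - p') / q"
    if "q > 0" for q p p' :: real
    using that by (simp add: field_simps)
  note this[OF q]
  ultimately show ?thesis
    unfolding A B by simp
qed

text \<open>
  After multiplication by \<open>(\<surd>q)\<^sup>t\<close> the recurrence is the Chebyshev one,
  \<open>Q\<^sub>t\<^sub>+\<^sub>2 = 2 cos \<theta> Q\<^sub>t\<^sub>+\<^sub>1 - Q\<^sub>t\<close>, which \<open>sin ((m + t) \<theta>)\<close> satisfies for every shift \<open>m\<close>; the right-hand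
  side is the combination that matches \<open>Q\<^sub>0 = 1\<close> and \<open>Q\<^sub>1 = (2 q / k) cos \<theta>\<close>. The factor \<open>sin \<theta>\<close> avoids
  division at the end points and is absorbed later by the spectral density. For \<open>t = 0\<close> the second
  frequency is \<open>-1\<close>, whence the real subtraction.
\<close>

lemma residual_poly_trig:
  fixes \<theta> :: real
  assumes "k \<ge> 3"
  defines "q \<equiv> real k - 1"
  shows "sqrt q ^ t * real k * sin \<theta> * poly (residual_poly k t) (1 - 2 * sqrt q / real k * cos \<theta>)
    = q * sin ((real t + 1) * \<theta>) - sin ((real t - 1) * \<theta>)"
proof (induction t rule: induct_nat_012)
  case 0
  show ?case by (simp add: residual_poly_def q_def algebra_simps)
next
  case 1
  have "lambda_max k + lambda_min k = 2" by (simp add: lambda_max_def lambda_min_def)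
  moreover have "sqrt q * sqrt q = q" using assms by simp
  ultimately show ?case
    using assms(1) by (simp add: residual_poly_def sin_double)
next
  case (ge2 t)
  let ?P = "\<lambda>t. poly (residual_poly k t) (1 - 2 * sqrt q / real k * cos \<theta>)"
  let ?s = "\<lambda>m. sin (m * \<theta>)"
  have q: "q > 0" and qq: "sqrt q * sqrt q = q" and k: "real k > 0" using assms by auto
  have three: "?s (m + 1) = 2 * cos \<theta> * ?s m - ?s (m - 1)" for m
    by (simp add: algebra_simps sin_add sin_diff)
  have P: "?P (Suc (Suc t)) = (2 * sqrt q * cos \<theta> * ?P (Suc t) - ?P t) / q"
    using k by (simp add: residual_poly_rec[OF assms(1)] flip: q_def)
  have power: "sqrt q ^ Suc (Suc t) = q * sqrt q ^ t"
    by (simp only: power_Suc mult.assoc[symmetric] qq)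
  have "sqrt q ^ Suc (Suc t) * real k * sin \<theta> * ?P (Suc (Suc t))
      = sqrt q ^ t * real k * sin \<theta> * (2 * sqrt q * cos \<theta> * ?P (Suc t) - ?P t)"
    unfolding P power using q by simp
  also have "\<dots> = 2 * cos \<theta> * (sqrt q ^ Suc t * real k * sin \<theta> * ?P (Suc t))
      - sqrt q ^ t * real k * sin \<theta> * ?P t"
    by (simp add: algebra_simps)
  also have "\<dots> = q * ?s (real (Suc (Suc t)) + 1) - ?s (real (Suc (Suc t)) - 1)"
  proof -
    have "?s (real (Suc (Suc t)) + 1) = 2 * cos \<theta> * ?s (real (Suc t) + 1) - ?s (real t + 1)"
      using three[of "real t + 2"] by (simp add: add.commute)
    moreover have "?s (real (Suc (Suc t)) - 1) = 2 * cos \<theta> * ?s (real (Suc t) - 1) - ?s (real t - 1)"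
      using three[of "real t"] by (simp add: add.commute)
    ultimately show ?thesis
      unfolding ge2.IH by (simp only: right_diff_distrib mult_ac)
  qed
  finally show ?case .
qed

section \<open>The spectral measure in the angular variable\<close>

text \<open>
  This is \<open>\<bar>q - exp (2 i \<theta>)\<bar>\<^sup>2\<close>, the denominator of the Poisson kernel, and \<open>k\<^sup>2\<close> times the
  denominator of the spectral density at \<open>1 - (2 \<surd>q / k) cos \<theta>\<close> when \<open>k = q + 1\<close>.
\<close>

definition angular_denominator :: "real \<Rightarrow> real \<Rightarrow> real" where
  "angular_denominator q \<theta> = q\<^sup>2 + 1 - 2 * q * cos (2 * \<theta>)"

lemma angular_denominator_pos:
  assumes "q > 1"
  shows "angular_denominator q \<theta> > 0"
proof -
  have "2 * q * cos (2 * \<theta>) \<le> 2 * q" using assms by simp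
  moreover have "(q - 1)\<^sup>2 > 0" using assms by simp
  ultimately show ?thesis
    by (simp add: angular_denominator_def power2_diff)
qed

lemma angular_denominator_cos:
  "angular_denominator q \<theta> = (q + 1)\<^sup>2 - 4 * q * (cos \<theta>)\<^sup>2"
  unfolding angular_denominator_def cos_double_cos power2_sum
  by (simp add: right_diff_distrib)

lemma continuous_on_angular_denominator [continuous_intros]:
  "continuous_on A (angular_denominator q)"
  unfolding angular_denominator_def by (intro continuous_intros)

text \<open>
  Substitution of \<open>x = 1 - (2 \<surd>q / k) cos \<theta>\<close>. The square root in the density turns into
  \<open>(2 \<surd>q / k) sin \<theta>\<close>, as does the derivative of the substitution; together they give \<open>(sin \<theta>)\<^sup>2\<close>.
\<close>

lemma integral_spectral_measure:
  fixes f :: "real \<Rightarrow> real"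
  assumes "k \<ge> 3" and f: "continuous_on UNIV f"
  defines "q \<equiv> real k - 1"
  shows "(\<integral>x. f x \<partial>spectral_measure k) = 2 * q * real k / pi *
    integral {0..pi} (\<lambda>\<theta>. f (1 - 2 * sqrt q / real k * cos \<theta>) * (sin \<theta>)\<^sup>2 / angular_denominator q \<theta>)"
proof -
  let ?c = "2 * sqrt q / real k"
  let ?I = "{lambda_min k..lambda_max k}"
  define w where "w x = real k / (2 * pi) *
       (sqrt (4 * (real k - 1) / (real k)\<^sup>2 - (1 - x)\<^sup>2) / (1 - (1 - x)\<^sup>2))" for x
  define g where "g \<theta> = 1 - ?c * cos \<theta>" for \<theta>
  have q: "q > 1" and k: "real k = q + 1" "real k > 0" using assms by auto
  have c: "?c\<^sup>2 = 4 * (real k - 1) / (real k)\<^sup>2" "?c > 0"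
    using q k(2) by (auto simp: power_divide power_mult_distrib q_def)
  \<comment> \<open>The support stays away from 0 and 2, where the denominator of the density vanishes.\<close>
  have c1: "?c < 1"
    using lambda_min_pos[OF assms(1)] by (simp add: lambda_min_def q_def)
  have inside: "(1 - x)\<^sup>2 \<le> ?c\<^sup>2" and den: "1 - (1 - x)\<^sup>2 > 0" if "x \<in> ?I" for x
  proof -
    have *: "\<bar>1 - x\<bar> \<le> ?c" using that by (auto simp: lambda_min_def lambda_max_def q_def)
    then show "(1 - x)\<^sup>2 \<le> ?c\<^sup>2" using power_mono[of "\<bar>1 - x\<bar>" ?c 2] by simp
    have "(1 - x)\<^sup>2 < 1" using * c1 by (simp add: abs_square_less_1)
    then show "1 - (1 - x)\<^sup>2 > 0" by simp
  qed
  have w_nonneg: "w x \<ge> 0" if "x \<in> ?I" for x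
    unfolding w_def using inside[OF that] den[OF that] c(1) k(2)
    by (intro mult_nonneg_nonneg divide_nonneg_nonneg) auto
  have [measurable]: "f \<in> borel_measurable borel"
    using f by (rule borel_measurable_continuous_onI)
  have "(\<integral>x. f x \<partial>spectral_measure k) = (\<integral>x. indicator ?I x * w x * f x \<partial>lborel)"
    unfolding spectral_measure_def w_def[symmetric]
  proof (subst integral_density)
    show "AE x in lborel. 0 \<le> indicator ?I x * w x"
      using w_nonneg by (intro AE_I2) (simp add: indicator_def)
    show "(\<lambda>x. indicator ?I x * w x) \<in> borel_measurable lborel"
      unfolding w_def by measurable
  qed simp_all
  also have "\<dots> = (\<integral>x. (f x * w x) * indicator {g 0..g pi} x \<partial>lborel)"
    by (simp add: g_def lambda_min_def lambda_max_def q_def mult_ac)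
  also have "\<dots> = (\<integral>\<theta>. (f (g \<theta>) * w (g \<theta>)) * (?c * sin \<theta>) * indicator {0..pi} \<theta> \<partial>lborel)"
  proof (rule integral_substitution(2))
    have "{g 0..g pi} = ?I" by (simp add: g_def lambda_min_def lambda_max_def q_def)
    moreover have "continuous_on ?I (\<lambda>x. f x * w x)"
      unfolding w_def using den
      by (intro continuous_intros continuous_on_subset[OF f]) (auto simp: less_imp_neq[symmetric])
    ultimately show "set_integrable lborel {g 0..g pi} (\<lambda>x. f x * w x)"
      using borel_integrable_atLeastAtMost' by metis
    show "(g has_real_derivative ?c * sin \<theta>) (at \<theta>)" for \<theta>
      unfolding g_def using k(2) by (auto intro!: derivative_eq_intros)
    show "0 \<le> ?c * sin \<theta>" if "\<theta> \<in> {0..pi}" for \<theta>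
      using that c(2) by (intro mult_nonneg_nonneg sin_ge_zero) auto
  qed (use k(2) in \<open>auto intro!: continuous_intros\<close>)
  also have "\<dots> = (LINT \<theta>:{0..pi}|lborel. 2 * q * real k / pi *
      (f (1 - ?c * cos \<theta>) * (sin \<theta>)\<^sup>2 / angular_denominator q \<theta>))"
    unfolding set_lebesgue_integral_def
  proof (rule Bochner_Integration.integral_cong[OF refl])
    fix \<theta> :: real
    have weight: "w (g \<theta>) * (?c * sin \<theta>) = 2 * q * real k / pi * ((sin \<theta>)\<^sup>2 / angular_denominator q \<theta>)"
      if "\<theta> \<in> {0..pi}"
    proof -
      have "?c\<^sup>2 - (1 - g \<theta>)\<^sup>2 = (?c * sin \<theta>)\<^sup>2"
        by (simp add: g_def power_mult_distrib power_divide sin_squared_eq right_diff_distrib diff_divide_distrib)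
      moreover have "0 \<le> ?c * sin \<theta>"
        using that c(2) by (intro mult_nonneg_nonneg sin_ge_zero) auto
      ultimately have "sqrt (4 * (real k - 1) / (real k)\<^sup>2 - (1 - g \<theta>)\<^sup>2) = ?c * sin \<theta>"
        unfolding c(1)[symmetric] by (simp only: real_sqrt_abs abs_of_nonneg)
      moreover have "1 - (1 - g \<theta>)\<^sup>2 = angular_denominator q \<theta> / (real k)\<^sup>2"
        unfolding angular_denominator_cos g_def k(1)[symmetric] using q k(2)
        by (simp add: power_mult_distrib power_divide diff_divide_distrib)
      ultimately have "w (g \<theta>) * (?c * sin \<theta>) = real k / (2 * pi) *
          ((?c * sin \<theta>) / (angular_denominator q \<theta> / (real k)\<^sup>2)) * (?c * sin \<theta>)"
        by (simp only: w_def)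
      also have "\<dots> = real k ^ 3 / (2 * pi) * (?c\<^sup>2 * (sin \<theta>)\<^sup>2 / angular_denominator q \<theta>)"
        by (simp add: power2_eq_square power3_eq_cube)
      also have "\<dots> = 2 * q * real k / pi * ((sin \<theta>)\<^sup>2 / angular_denominator q \<theta>)"
        unfolding c(1) q_def[symmetric] using k(2)
        by (simp add: power2_eq_square power3_eq_cube)
      finally show ?thesis .
    qed
    show "(f (g \<theta>) * w (g \<theta>)) * (?c * sin \<theta>) * indicator {0..pi} \<theta> =
       indicator {0..pi} \<theta> *\<^sub>R (2 * q * real k / pi *
      (f (1 - ?c * cos \<theta>) * (sin \<theta>)\<^sup>2 / angular_denominator q \<theta>))"
    proof (cases "\<theta> \<in> {0..pi}")
      case True
      have "(f (g \<theta>) * w (g \<theta>)) * (?c * sin \<theta>)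
          = f (g \<theta>) * (2 * q * real k / pi * ((sin \<theta>)\<^sup>2 / angular_denominator q \<theta>))"
        by (simp only: mult.assoc[of "f (g \<theta>)"] weight[OF True])
      then show ?thesis using True by (simp add: g_def)
    qed simp
  qed
  also have "\<dots> = integral {0..pi} (\<lambda>\<theta>. 2 * q * real k / pi *
      (f (1 - ?c * cos \<theta>) * (sin \<theta>)\<^sup>2 / angular_denominator q \<theta>))"
    using angular_denominator_pos[OF q]
    by (intro set_borel_integral_eq_integral(2) borel_integrable_atLeastAtMost' continuous_intros
        continuous_on_compose2[OF f]) (auto simp: less_imp_neq[symmetric])
  finally show ?thesis by (simp only: integral_mult_right)
qed

section \<open>Vanishing of the oscillating part\<close>

text \<open>
  With \<open>z = exp (2 i \<theta>)\<close> this is the real part of \<open>z\<^sup>t\<^sup>-\<^sup>1 (q z - 1)\<^sup>2\<close>.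
\<close>

definition oscillation :: "real \<Rightarrow> nat \<Rightarrow> real \<Rightarrow> real" where
  "oscillation q t \<theta> = q\<^sup>2 * cos (2 * (real t + 1) * \<theta>) - 2 * q * cos (2 * real t * \<theta>)
     + cos (2 * (real t - 1) * \<theta>)"

lemma continuous_on_oscillation [continuous_intros]: "continuous_on A (oscillation q t)"
  unfolding oscillation_def by (intro continuous_intros)

lemma cos_product_expand:
  fixes a b :: real
  shows "2 * cos a * cos b = cos (a + b) + cos (a - b)"
    "2 * sin a * sin b = cos (a - b) - cos (a + b)"
  by (simp_all add: cos_add cos_diff)

text \<open>
  For \<open>w = exp (i (t - 1) \<theta>) (q z - 1)\<close> with \<open>z = exp (2 i \<theta>)\<close>, this and the next lemma are
  \<open>2 (Im w)\<^sup>2 = \<bar>w\<bar>\<^sup>2 - Re (w\<^sup>2)\<close> and \<open>2 (Re w)\<^sup>2 = \<bar>w\<bar>\<^sup>2 + Re (w\<^sup>2)\<close>.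
\<close>

lemma sin_combination_squared:
  "2 * (q * sin ((real t + 1) * \<theta>) - sin ((real t - 1) * \<theta>))\<^sup>2
    = angular_denominator q \<theta> - oscillation q t \<theta>"
proof -
  let ?a = "(real t + 1) * \<theta>" and ?b = "(real t - 1) * \<theta>"
  have "2 * (q * sin ?a - sin ?b)\<^sup>2
      = q\<^sup>2 * (2 * sin ?a * sin ?a) - 2 * q * (2 * sin ?a * sin ?b) + 2 * sin ?b * sin ?b"
    by (simp add: power2_eq_square algebra_simps)
  also have "\<dots> = angular_denominator q \<theta> - oscillation q t \<theta>"
    unfolding cos_product_expand angular_denominator_def oscillation_def
    by (simp add: algebra_simps)
  finally show ?thesis .
qed

lemma cos_combination_squared:
  "2 * (q * cos ((real t + 1) * \<theta>) - cos ((real t - 1) * \<theta>))\<^sup>2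
    = angular_denominator q \<theta> + oscillation q t \<theta>"
proof -
  let ?a = "(real t + 1) * \<theta>" and ?b = "(real t - 1) * \<theta>"
  have "2 * (q * cos ?a - cos ?b)\<^sup>2
      = q\<^sup>2 * (2 * cos ?a * cos ?a) - 2 * q * (2 * cos ?a * cos ?b) + 2 * cos ?b * cos ?b"
    by (simp add: power2_eq_square algebra_simps)
  also have "\<dots> = angular_denominator q \<theta> + oscillation q t \<theta>"
    unfolding cos_product_expand angular_denominator_def oscillation_def
    by (simp add: algebra_simps)
  finally show ?thesis .
qed

lemma abs_oscillation_le: "\<bar>oscillation q t \<theta>\<bar> \<le> angular_denominator q \<theta>"
proof -
  have "0 \<le> angular_denominator q \<theta> - oscillation q t \<theta>"
    unfolding sin_combination_squared[symmetric] by simp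
  moreover have "0 \<le> angular_denominator q \<theta> + oscillation q t \<theta>"
    unfolding cos_combination_squared[symmetric] by simp
  ultimately show ?thesis by linarith
qed

text \<open>
  On the unit circle \<open>(q z - 1) (q - z) = z \<bar>q - z\<bar>\<^sup>2\<close>. Hence multiplying \<open>z\<^sup>t\<^sup>-\<^sup>1 (q z - 1)\<^sup>2\<close> by \<open>q - z\<close>
  splits off the denominator and leaves the trigonometric polynomial \<open>z\<^sup>t (q z - 1)\<close>.
\<close>

lemma oscillation_rec:
  "q * oscillation q t \<theta> - oscillation q (Suc t) \<theta> =
    angular_denominator q \<theta> * (q * cos (2 * (real t + 1) * \<theta>) - cos (2 * real t * \<theta>))"
proof -
  have "angular_denominator q \<theta> * (q * cos (2 * (real t + 1) * \<theta>) - cos (2 * real t * \<theta>))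
    = (q\<^sup>2 + 1) * (q * cos (2 * (real t + 1) * \<theta>) - cos (2 * real t * \<theta>))
     - q\<^sup>2 * (2 * cos (2 * (real t + 1) * \<theta>) * cos (2 * \<theta>))
     + q * (2 * cos (2 * real t * \<theta>) * cos (2 * \<theta>))"
    by (simp add: angular_denominator_def algebra_simps power2_eq_square)
  also have "\<dots> = q * oscillation q t \<theta> - oscillation q (Suc t) \<theta>"
    unfolding cos_product_expand oscillation_def
    by (simp add: algebra_simps power2_eq_square)
  finally show ?thesis by simp
qed

lemma has_integral_cos_even_multiple:
  fixes m :: nat
  assumes "m > 0"
  shows "((\<lambda>\<theta>. cos (2 * real m * \<theta>)) has_integral 0) {0..pi}"
proof -
  have "((\<lambda>\<theta>. cos (2 * real m * \<theta>)) has_integral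
      sin (2 * real m * pi) / (2 * real m) - sin (2 * real m * 0) / (2 * real m)) {0..pi}"
    using assms
    by (intro fundamental_theorem_of_calculus)
      (auto intro!: derivative_eq_intros simp flip: has_real_derivative_iff_has_vector_derivative)
  moreover have "sin (2 * real m * pi) = 0"
    using sin_npi[of "2 * m"] by simp
  ultimately show ?thesis by simp
qed

text \<open>
  Divided by the denominator, \<open>oscillation_rec\<close> has on its right-hand side only cosines of nonzero
  frequency as long as \<open>t > 0\<close>, and these integrate to \<open>0\<close>. So the integrals grow by the factor
  \<open>q > 1\<close> at each step, which is incompatible with the bound \<open>\<pi>\<close> unless they vanish. For \<open>t = 0\<close> the
  frequency \<open>0\<close> occurs, and the integral is not \<open>0\<close>.
\<close>

lemma integral_oscillation_eq_0:
  assumes "q > 1" "t > 0"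
  shows "integral {0..pi} (\<lambda>\<theta>. oscillation q t \<theta> / angular_denominator q \<theta>) = 0"
proof -
  define F where "F t \<theta> = oscillation q t \<theta> / angular_denominator q \<theta>" for t \<theta>
  define I where "I t = integral {0..pi} (F t)" for t
  have D: "angular_denominator q \<theta> > 0" for \<theta>
    using assms(1) by (rule angular_denominator_pos)
  have F_int: "F t integrable_on {0..pi}" for t
    unfolding F_def using D
    by (intro integrable_continuous_interval continuous_intros) (auto simp: less_imp_neq[symmetric])
  have bound: "\<bar>I n\<bar> \<le> pi" for n
  proof -
    have "\<bar>F n \<theta>\<bar> \<le> 1" for \<theta>
      using abs_oscillation_le[of q n \<theta>] D[of \<theta>] by (simp add: F_def abs_divide)
    then have "norm (I n) \<le> integral {0..pi} (\<lambda>_. 1)"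
      unfolding I_def by (intro integral_norm_bound_integral F_int) auto
    then show ?thesis by simp
  qed
  have step: "I (Suc n) = q * I n" if "n > 0" for n
  proof -
    have "((\<lambda>\<theta>. q * cos (2 * real (Suc n) * \<theta>) - cos (2 * real n * \<theta>))
        has_integral q * 0 - 0) {0..pi}"
      using that
      by (intro has_integral_diff has_integral_mult_right has_integral_cos_even_multiple) auto
    moreover have "q * cos (2 * real (Suc n) * \<theta>) - cos (2 * real n * \<theta>) = q * F n \<theta> - F (Suc n) \<theta>"
      for \<theta>
      using oscillation_rec[of q n \<theta>] D[of \<theta>]
      by (simp add: F_def add.commute flip: times_divide_eq_right) (simp add: field_simps)
    ultimately have "((\<lambda>\<theta>. q * F n \<theta> - F (Suc n) \<theta>) has_integral 0) {0..pi}"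
      by simp
    moreover have "((\<lambda>\<theta>. q * F n \<theta> - F (Suc n) \<theta>) has_integral q * I n - I (Suc n)) {0..pi}"
      unfolding I_def
      by (intro has_integral_diff has_integral_mult_right integrable_integral F_int)
    ultimately have "q * I n - I (Suc n) = 0"
      by (rule has_integral_unique[rotated])
    then show ?thesis by simp
  qed
  have growth: "I (t + m) = q ^ m * I t" for m
    by (induction m) (use assms(2) step in auto)
  have "I t = 0"
  proof (rule ccontr)
    assume "I t \<noteq> 0"
    then obtain m where "pi / \<bar>I t\<bar> < q ^ m"
      using real_arch_pow[OF assms(1)] by blast
    then have "pi < \<bar>I (t + m)\<bar>"
      unfolding growth using \<open>I t \<noteq> 0\<close> assms(1) by (simp add: abs_mult field_simps)
    then show False using bound[of "t + m"] by simp
  qed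
  then show ?thesis by (simp add: I_def F_def[abs_def])
qed

section \<open>The expected error\<close>

text \<open>
  The scaled residual polynomials have the same norm in \<open>L\<^sup>2\<close> of the spectral measure for all
  \<open>t \<ge> 1\<close>, because the oscillating part of their squares integrates to \<open>0\<close>.
\<close>

theorem expected_error_eq:
  assumes "k \<ge> 3" "t > 0"
  shows "expected_error k R t = R\<^sup>2 * ((real k - 1) / real k) * (1 / (real k - 1)) ^ t"
proof -
  define q where "q = real k - 1"
  let ?P = "\<lambda>\<theta>. poly (residual_poly k t) (1 - 2 * sqrt q / real k * cos \<theta>)"
  let ?D = "angular_denominator q"
  have q: "q > 1" and k: "real k > 0" using assms by (auto simp: q_def)
  have D: "?D \<theta> > 0" for \<theta>
    using q by (rule angular_denominator_pos)
  have integrand: "(?P \<theta>)\<^sup>2 * (sin \<theta>)\<^sup>2 / ?D \<theta>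
      = 1 / (2 * (real k)\<^sup>2 * q ^ t) * (1 - oscillation q t \<theta> / ?D \<theta>)" for \<theta>
  proof -
    have "(sqrt q ^ t)\<^sup>2 = q ^ t"
      using q by (simp add: power2_eq_square flip: power_mult_distrib)
    then have "q ^ t * (real k)\<^sup>2 * ((?P \<theta>)\<^sup>2 * (sin \<theta>)\<^sup>2) = (sqrt q ^ t * real k * sin \<theta> * ?P \<theta>)\<^sup>2"
      by (simp add: power_mult_distrib mult_ac)
    also have "\<dots> = (?D \<theta> - oscillation q t \<theta>) / 2"
      unfolding q_def residual_poly_trig[OF assms(1)] by (simp flip: sin_combination_squared)
    finally have "(?P \<theta>)\<^sup>2 * (sin \<theta>)\<^sup>2 = (?D \<theta> - oscillation q t \<theta>) / (2 * (real k)\<^sup>2 * q ^ t)"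
      using q k by (simp add: field_simps)
    then show ?thesis using D[of \<theta>] by (simp add: diff_divide_distrib right_diff_distrib)
  qed
  have osc: "(\<lambda>\<theta>. oscillation q t \<theta> / ?D \<theta>) integrable_on {0..pi}"
    using D by (intro integrable_continuous_interval continuous_intros)
      (auto simp: less_imp_neq[symmetric])
  have "integral {0..pi} (\<lambda>\<theta>. (?P \<theta>)\<^sup>2 * (sin \<theta>)\<^sup>2 / ?D \<theta>) = pi / (2 * (real k)\<^sup>2 * q ^ t)"
    unfolding integrand using integral_oscillation_eq_0[OF q assms(2)] 
    by (simp only: integral_mult_right integral_diff[OF integrable_const_ivl osc]) simp
  moreover have "continuous_on UNIV (\<lambda>x. (poly (residual_poly k t) x)\<^sup>2)"
    by (intro continuous_intros)
  ultimately have "expected_error k R t = R\<^sup>2 * (2 * q * real k / pi * (pi / (2 * (real k)\<^sup>2 * q ^ t)))"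
    using integral_spectral_measure[OF assms(1), of "\<lambda>x. (poly (residual_poly k t) x)\<^sup>2"]
    by (simp add: expected_error_def q_def)
  then show ?thesis
    using q k by (simp add: power_divide field_simps power2_eq_square flip: q_def)
qed

theorem theorem5p3:
  fixes k :: nat and R :: real
  assumes "k \<ge> 3" and "R > 0"
  shows "(\<lambda>t. expected_error k R t) \<in> \<Theta>(\<lambda>t. (1 / (real k - 1)) ^ t)"
proof -
  let ?c = "R\<^sup>2 * ((real k - 1) / real k)"
  have "\<forall>\<^sub>F t in sequentially. expected_error k R t = ?c * (1 / (real k - 1)) ^ t"
    using eventually_gt_at_top[of 0]
    by eventually_elim (rule expected_error_eq[OF assms(1)])
  then have "(\<lambda>t. expected_error k R t) \<in> \<Theta>(\<lambda>t. ?c * (1 / (real k - 1)) ^ t)"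
    by (rule bigthetaI_cong)
  also have "(\<lambda>t. ?c * (1 / (real k - 1)) ^ t) \<in> \<Theta>(\<lambda>t. (1 / (real k - 1)) ^ t)"
    using assms by simp
  finally show ?thesis .
qed

end
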